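(* Let $1<p<\infty$ with $p\neq 2$. There exist $p$-operator spaces $V\subseteq W$, a space $E\in SQ_p$, and a $p$-completely contractive map $\varphi:V\to\mathcal{B}(E)$ such that $\varphi$ does not extend to a $p$-completely contractive map $\tilde\varphi:W\to\mathcal{B}(E)$.
   Context: All spaces are complex. $SQ_p$ denotes the collection of Banach spaces that are (isometrically) subspaces of quotients of $L_p$ spaces. For a vector space $X$, $\mathbb{M}_{n,m}(X)$ is the space of $n\times m$ matrices over $X$, $\mathbb{M}_n(X)=\mathbb{M}_{n,n}(X)$, and $\mathbb{M}_{n,m}=\mathbb{M}_{n,m}(\mathbb{C})$. A $p$-operator space is a Banach space $X$ together with norms $\|\cdot\|_n$ on $\mathbb{M}_n(X)$, $n\ge1$ (with $\|\cdot\|_1$ the norm of $X$), such that, writing $M_n(X)=(\mathbb{M}_n(X),\|\cdot\|_n)$: (1) $\|u\oplus v\|_{n+m}=\max\{\|u\|_n,\|v\|_m\}$ for $u\in M_n(X)$, $v\in M_m(X)$; (2) $\|\alpha u\beta\|_n\le\|\alpha\|\,\|u\|_m\,\|\beta\|$ for $u\in M_m(X)$, $\alpha\in\mathbb{M}_{n,m}$, $\beta\in\mathbb{M}_{m,n}$, where $\|\alpha\|$ is the norm in $\mathcal{B}(\ell_p^m,\ell_p^n)$ and $\|\beta\|$ the norm in $\mathcal{B}(\ell_p^n,\ell_p^m)$. By Le Merdy's theorem these are exactly (up to isometry at all matrix levels) the closed subspaces of $\mathcal{B}(F)$, $F\in SQ_p$, with the norms inherited from $\mathbb{M}_n(\mathcal{B}(F))=\mathcal{B}(\ell_p^n(F))$,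 where $\ell_p^n(F)$ is the $\ell_p$ direct sum of $n$ copies of $F$. For $E\in SQ_p$, $\mathcal{B}(E)$ (the bounded operators on $E$) carries this $p$-operator space structure. $V\subseteq W$ means that $V$ is a closed subspace of $W$ with the matrix norms inherited from $W$. A linear map $u:X\to Y$ between $p$-operator spaces induces $u_n:M_n(X)\to M_n(Y)$ entrywise; $u$ is $p$-completely contractive if $\sup_n\|u_n\|\le1$. *)

theory Defs
  imports "HOL-Analysis.Analysis" "HOL-Library.Function_Algebras" "Jordan_Normal_Form.Matrix"
begin

section \<open>Complex Banach spaces with explicit carriers\<close>

text \<open>
  Spaces have to be quantified existentially, so they are records on top of an ambient abelian group.
  The carrier is a linear subspace for a scalar multiplication that is part of the record; nothing is
  required of the norm outside the carrier. With ambient type \<open>nat \<Rightarrow> complex\<close>, whose dimension is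
  the continuum, these records cover all complex Banach spaces of at most that cardinality up to
  isometric isomorphism.
\<close>

record 'a cspace =
  carr :: "'a set"
  scl :: "complex \<Rightarrow> 'a \<Rightarrow> 'a"
  nrm :: "'a \<Rightarrow> real"

definition norm_on ::
  "'b::plus set \<Rightarrow> (complex \<Rightarrow> 'b \<Rightarrow> 'b) \<Rightarrow> 'b \<Rightarrow> ('b \<Rightarrow> real) \<Rightarrow> bool" where
  "norm_on S sc z N \<longleftrightarrow>
     (\<forall>x\<in>S. 0 \<le> N x) \<and>
     (\<forall>x\<in>S. N x = 0 \<longleftrightarrow> x = z) \<and>
     (\<forall>c. \<forall>x\<in>S. N (sc c x) = cmod c * N x) \<and>
     (\<forall>x\<in>S. \<forall>y\<in>S. N (x + y) \<le> N x + N y)"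

definition complete_in :: "('a::ab_group_add) set \<Rightarrow> ('a \<Rightarrow> real) \<Rightarrow> bool" where
  "complete_in S N \<longleftrightarrow>
     (\<forall>s :: nat \<Rightarrow> 'a.
        range s \<subseteq> S \<longrightarrow>
        (\<forall>e>0. \<exists>k. \<forall>m\<ge>k. \<forall>n\<ge>k. N (s m - s n) < e) \<longrightarrow>
        (\<exists>l\<in>S. (\<lambda>n. N (s n - l)) \<longlonglongrightarrow> 0))"

definition closed_in :: "('a::ab_group_add) set \<Rightarrow> ('a \<Rightarrow> real) \<Rightarrow> 'a set \<Rightarrow> bool" where
  "closed_in S N T \<longleftrightarrow>
     T \<subseteq> S \<and> (\<forall>x\<in>S. (\<forall>e>0. \<exists>y\<in>T. N (x - y) < e) \<longrightarrow> x \<in> T)"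

definition banach_space :: "('a::ab_group_add, 'z) cspace_scheme \<Rightarrow> bool" where
  "banach_space X \<longleftrightarrow>
     vector_space (scl X) \<and> module.subspace (scl X) (carr X) \<and>
     norm_on (carr X) (scl X) 0 (nrm X) \<and> complete_in (carr X) (nrm X)"

definition linear_map ::
  "('a::ab_group_add, 'z) cspace_scheme \<Rightarrow> ('b::ab_group_add, 'w) cspace_scheme \<Rightarrow> ('a \<Rightarrow> 'b) \<Rightarrow> bool" where
  "linear_map X Y f \<longleftrightarrow>
     (\<forall>x\<in>carr X. f x \<in> carr Y) \<and>
     (\<forall>x\<in>carr X. \<forall>y\<in>carr X. f (x + y) = f x + f y) \<and>
     (\<forall>c. \<forall>x\<in>carr X. f (scl X c x) = scl Y c (f x))"


section \<open>Subspaces of quotients of \<open>L\<^sub>p\<close>\<close>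

text \<open>
  \<open>L\<^sub>p(M)\<close> is represented by the \<open>p\<close>-integrable functions with their \<open>p\<close>-seminorm. A closed
  subspace of it contains all null functions, so passing to a quotient by a closed subspace
  includes the identification of functions that agree almost everywhere.
\<close>

definition Lp_fun :: "real \<Rightarrow> 'm measure \<Rightarrow> ('m \<Rightarrow> complex) set" where
  "Lp_fun p M = {f \<in> borel_measurable M. integrable M (\<lambda>t. cmod (f t) powr p)}"

definition Lp_norm :: "real \<Rightarrow> 'm measure \<Rightarrow> ('m \<Rightarrow> complex) \<Rightarrow> real" where
  "Lp_norm p M f = (\<integral>t. cmod (f t) powr p \<partial>M) powr (1 / p)"

definition fun_scale :: "complex \<Rightarrow> ('m \<Rightarrow> complex) \<Rightarrow> 'm \<Rightarrow> complex" where
  "fun_scale c f = (\<lambda>t. c * f t)"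

definition quotient_norm :: "('b::minus \<Rightarrow> real) \<Rightarrow> 'b set \<Rightarrow> 'b \<Rightarrow> real" where
  "quotient_norm N K f = (INF g\<in>K. N (f - g))"

text \<open>
  \<open>J\<close> picks representatives of a linear isometric embedding of \<open>E\<close> into \<open>L\<^sub>p(M) / K\<close>, hence it is
  linear modulo \<open>K\<close>. The type of the underlying set of \<open>M\<close> is a parameter because types cannot be
  quantified; for \<open>E\<close> of at most continuum cardinality, measures on \<open>real \<Rightarrow> real\<close> suffice to
  represent every \<open>E\<close> that embeds in a quotient of some \<open>L\<^sub>p\<close>.
\<close>

definition SQ_p :: "'m itself \<Rightarrow> real \<Rightarrow> ('a::ab_group_add) cspace \<Rightarrow> bool" where
  "SQ_p T p E \<longleftrightarrow>
     banach_space E \<and>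
     (\<exists>(M :: 'm measure) K J.
        module.subspace fun_scale K \<and> closed_in (Lp_fun p M) (Lp_norm p M) K \<and>
        (\<forall>x\<in>carr E. J x \<in> Lp_fun p M) \<and>
        (\<forall>x\<in>carr E. \<forall>y\<in>carr E. J (x + y) - (J x + J y) \<in> K) \<and>
        (\<forall>c. \<forall>x\<in>carr E. J (scl E c x) - fun_scale c (J x) \<in> K) \<and>
        (\<forall>x\<in>carr E. quotient_norm (Lp_norm p M) K (J x) = nrm E x))"


section \<open>\<open>p\<close>-operator spaces\<close>

record 'a pspace = "'a cspace" +
  mnrm :: "nat \<Rightarrow> 'a mat \<Rightarrow> real"

definition mats :: "nat \<Rightarrow> ('a, 'z) cspace_scheme \<Rightarrow> 'a mat set" where
  "mats n X = {u \<in> carrier_mat n n. elements_mat u \<subseteq> carr X}"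

text \<open>The norm of \<open>\<ell>\<^sub>p\<^sup>n(F)\<close>, where \<open>N\<close> is the norm of \<open>F\<close>.\<close>

definition lp_norm :: "real \<Rightarrow> ('a \<Rightarrow> real) \<Rightarrow> 'a Matrix.vec \<Rightarrow> real" where
  "lp_norm p N x = (\<Sum>i<dim_vec x. N (vec_index x i) powr p) powr (1 / p)"

definition scalar_mat_norm :: "real \<Rightarrow> complex mat \<Rightarrow> real" where
  "scalar_mat_norm p \<alpha> =
     (SUP x\<in>{x \<in> carrier_vec (dim_col \<alpha>). lp_norm p cmod x \<le> 1}. lp_norm p cmod (\<alpha> *\<^sub>v x))"

definition direct_sum :: "('a::zero) mat \<Rightarrow> 'a mat \<Rightarrow> 'a mat" where
  "direct_sum u v =
     four_block_mat u (0\<^sub>m (dim_row u) (dim_col v)) (0\<^sub>m (dim_row v) (dim_col u)) v"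

definition two_sided_mult ::
  "(complex \<Rightarrow> 'a::ab_group_add \<Rightarrow> 'a) \<Rightarrow> complex mat \<Rightarrow> 'a mat \<Rightarrow> complex mat \<Rightarrow> 'a mat" where
  "two_sided_mult sc \<alpha> u \<beta> =
     mat (dim_row \<alpha>) (dim_col \<beta>)
       (\<lambda>(i, j). \<Sum>k<dim_row u. \<Sum>l<dim_col u. sc (\<alpha> $$ (i, k) * \<beta> $$ (l, j)) (u $$ (k, l)))"

definition p_operator_space :: "real \<Rightarrow> ('a::ab_group_add) pspace \<Rightarrow> bool" where
  "p_operator_space p X \<longleftrightarrow>
     banach_space X \<and>
     (\<forall>n\<ge>1. norm_on (mats n X) (\<lambda>c. map_mat (scl X c)) (0\<^sub>m n n) (mnrm X n)) \<and>
     (\<forall>x\<in>carr X. mnrm X 1 (mat 1 1 (\<lambda>_. x)) = nrm X x) \<and>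
     (\<forall>n\<ge>1. \<forall>m\<ge>1. \<forall>u\<in>mats n X. \<forall>v\<in>mats m X.
        mnrm X (n + m) (direct_sum u v) = max (mnrm X n u) (mnrm X m v)) \<and>
     (\<forall>n\<ge>1. \<forall>m\<ge>1. \<forall>u\<in>mats m X. \<forall>\<alpha>\<in>carrier_mat n m. \<forall>\<beta>\<in>carrier_mat m n.
        mnrm X n (two_sided_mult (scl X) \<alpha> u \<beta>)
          \<le> scalar_mat_norm p \<alpha> * mnrm X m u * scalar_mat_norm p \<beta>)"

definition p_subspace :: "('a::ab_group_add) pspace \<Rightarrow> 'a pspace \<Rightarrow> bool" where
  "p_subspace V W \<longleftrightarrow>
     closed_in (carr W) (nrm W) (carr V) \<and>
     (\<forall>c. \<forall>x\<in>carr V. scl V c x = scl W c x) \<and>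
     (\<forall>x\<in>carr V. nrm V x = nrm W x) \<and>
     (\<forall>n\<ge>1. \<forall>u\<in>mats n V. mnrm V n u = mnrm W n u)"

text \<open>
  Operators on \<open>E\<close> are normalised to vanish off the carrier of \<open>E\<close>, so that equality of functions
  is equality of operators and the operators form a linear subspace of the function type.
\<close>

definition bounded_ops :: "('a::ab_group_add) cspace \<Rightarrow> ('a \<Rightarrow> 'a) set" where
  "bounded_ops E =
     {T. linear_map E E T \<and> (\<exists>C. \<forall>x\<in>carr E. nrm E (T x) \<le> C * nrm E x) \<and>
         (\<forall>x. x \<notin> carr E \<longrightarrow> T x = 0)}"

definition op_mat_mult :: "('a \<Rightarrow> 'a::ab_group_add) mat \<Rightarrow> 'a Matrix.vec \<Rightarrow> 'a Matrix.vec" where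
  "op_mat_mult u x =
     Matrix.vec (dim_row u) (\<lambda>i. \<Sum>j<dim_col u. (u $$ (i, j)) (vec_index x j))"

definition op_space :: "real \<Rightarrow> ('a::ab_group_add) cspace \<Rightarrow> ('a \<Rightarrow> 'a) pspace" where
  "op_space p E =
     \<lparr> carr = bounded_ops E,
       scl = (\<lambda>c T x. scl E c (T x)),
       nrm = (\<lambda>T. SUP x\<in>{x \<in> carr E. nrm E x \<le> 1}. nrm E (T x)),
       mnrm = (\<lambda>n u.
         SUP x\<in>{x \<in> carrier_vec n. set\<^sub>v x \<subseteq> carr E \<and> lp_norm p (nrm E) x \<le> 1}.
           lp_norm p (nrm E) (op_mat_mult u x)) \<rparr>"

definition p_completely_contractive ::
  "('a::ab_group_add) pspace \<Rightarrow> ('b::ab_group_add) pspace \<Rightarrow> ('a \<Rightarrow> 'b) \<Rightarrow> bool" where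
  "p_completely_contractive X Y f \<longleftrightarrow>
     linear_map X Y f \<and> (\<forall>n\<ge>1. \<forall>u\<in>mats n X. mnrm Y n (map_mat f u) \<le> mnrm X n u)"

end

(*
A space F in SQ_p becomes a p-operator space by identifying x in F with the column operator C -> F,
c |-> c x. Let W be the column space of l_p^3 and V that of its hyperplane E = {x. x0 + x1 + x2 = 0}.
Choose e in E and a functional f on E with |e| = |f| = f e = 1. Then phi x = f(.) x is p-completely
contractive from V to B(E), and for an extension psi to W the map P x = psi x e is a contractive
projection of l_p^3 onto E. There is none for p ~= 2: a vector h in the kernel of P with coordinate
sum 1 satisfies |y| <= |y + t h| for all y in E and real t. Summing the p-th powers over the three
permutations y of (2, -1, -1) and differentiating at t = 0 gives 2^(p-1) - 2 = 0.
*)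

theory Submission
  imports Defs
begin

section \<open>The norm of \<open>\<ell>\<^sub>p\<close> on finite index sets\<close>

text \<open>The index set is arbitrary so that the product of \<open>{..<n}\<close> and
  \<open>{..<d}\<close> turns l_p^n(l_p^d) into a single l_p space. Values of \<open>f\<close>
  outside \<open>A\<close> are ignored.\<close>

definition lpn :: "real \<Rightarrow> 'i set \<Rightarrow> ('i \<Rightarrow> complex) \<Rightarrow> real" where
  "lpn p A f = (\<Sum>i\<in>A. cmod (f i) powr p) powr (1 / p)"

lemma lpn_cong: "A = B \<Longrightarrow> (\<And>i. i \<in> B \<Longrightarrow> f i = g i) \<Longrightarrow> lpn p A f = lpn p B g"
  by (simp add: lpn_def)

lemma lpn_nonneg [simp]: "0 \<le> lpn p A f"
  by (simp add: lpn_def)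

lemma lpn_powr:
  assumes "1 < p"
  shows "lpn p A f powr p = (\<Sum>i\<in>A. cmod (f i) powr p)"
  using assms by (simp add: lpn_def powr_powr sum_nonneg)

lemma lpn_le_iff:
  assumes "1 < p" "0 \<le> C"
  shows "lpn p A f \<le> C \<longleftrightarrow> (\<Sum>i\<in>A. cmod (f i) powr p) \<le> C powr p"
proof -
  have "lpn p A f \<le> C \<longleftrightarrow> lpn p A f powr p \<le> C powr p"
    using assms powr_mono2[of p "lpn p A f" C] powr_less_mono2[of p C "lpn p A f"]
    by (auto simp: not_le[symmetric])
  then show ?thesis using lpn_powr[OF assms(1)] by metis
qed

lemma lpn_eqI:
  assumes "1 < p" "0 \<le> C" "(\<Sum>i\<in>A. cmod (f i) powr p) = C powr p"
  shows "lpn p A f = C"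
  using assms by (simp add: lpn_def powr_powr)

lemma lpn_scale:
  assumes "1 < p"
  shows "lpn p A (\<lambda>i. c * f i) = cmod c * lpn p A f"
  by (rule lpn_eqI[OF assms])
     (simp_all add: norm_mult powr_mult lpn_powr[OF assms] sum_distrib_left)

lemma coord_le_lpn:
  assumes "1 < p" "finite A" "i \<in> A"
  shows "cmod (f i) \<le> lpn p A f"
proof -
  have "cmod (f i) powr p \<le> (\<Sum>i\<in>A. cmod (f i) powr p)"
    by (rule member_le_sum) (use assms in auto)
  then have "(cmod (f i) powr p) powr (1 / p) \<le> lpn p A f"
    unfolding lpn_def using assms by (intro powr_mono2) auto
  then show ?thesis using assms by (simp add: powr_powr)
qed

lemma lpn_zero_iff:
  assumes "1 < p" "finite A"
  shows "lpn p A f = 0 \<longleftrightarrow> (\<forall>i\<in>A. f i = 0)"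
  using assms by (auto simp: lpn_def sum_nonneg_eq_0_iff)

text \<open>For positive \<open>x\<close> and \<open>y\<close> this is convexity of the p-th power;
  if one of them is 0, it reduces to s^p \<le> s for s in [0, 1].\<close>

lemma powr_convex_combination:
  fixes x y t :: real
  assumes "1 < p" "0 \<le> x" "0 \<le> y" "0 \<le> t" "t \<le> 1"
  shows "((1 - t) * x + t * y) powr p \<le> (1 - t) * x powr p + t * y powr p"
proof -
  have small: "s powr p \<le> s" if "0 \<le> s" "s \<le> 1" for s :: real
    using powr_mono'[of 1 p s] that assms by (cases "s = 0") auto
  consider "x = 0" | "y = 0" | "0 < x" "0 < y" using assms by linarith
  then show ?thesis
  proof cases
    case 1
    then show ?thesis using assms small[of t] by (simp add: powr_mult mult_right_mono)
  next
    case 2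
    then show ?thesis using assms small[of "1 - t"] by (simp add: powr_mult mult_right_mono)
  next
    case 3
    then show ?thesis
      using convex_onD[OF powr_convex[of p], of t x y] assms by simp
  qed
qed

text \<open>Minkowski's inequality from convexity: with F and G the two norms, f + g is F + G times
  a convex combination of the unit vectors f / F and g / G, with weights F / (F + G) and G / (F +
  G).\<close>

lemma lpn_triangle:
  assumes "1 < p" "finite A"
  shows "lpn p A (\<lambda>i. f i + g i) \<le> lpn p A f + lpn p A g"
proof -
  let ?F = "lpn p A f" and ?G = "lpn p A g"
  consider "?F = 0" | "?G = 0" | "0 < ?F" "0 < ?G"
    using lpn_nonneg[of p A f] lpn_nonneg[of p A g] by linarith
  then show ?thesis
  proof cases
    case 1
    then have "lpn p A (\<lambda>i. f i + g i) = ?G"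
      using lpn_zero_iff[OF assms] by (intro lpn_cong) auto
    then show ?thesis by simp
  next
    case 2
    then have "lpn p A (\<lambda>i. f i + g i) = ?F"
      using lpn_zero_iff[OF assms] by (intro lpn_cong) auto
    then show ?thesis by simp
  next
    case 3
    define t where "t = ?G / (?F + ?G)"
    have t: "0 \<le> t" "t \<le> 1" "1 - t = ?F / (?F + ?G)"
      using 3 by (auto simp: t_def field_simps)
    have S: "0 < ?F + ?G" using 3 by simp
    \<comment> \<open>Convexity is applied in each coordinate. After summation the two normalised
      sums equal 1, and the weights add up to 1.\<close>
    have "cmod (f i + g i) powr p
        \<le> (?F + ?G) powr p * ((1 - t) * (cmod (f i) powr p / ?F powr p) + t * (cmod (g i) powr p / ?G powr p))" for i
    proof -
      have "?F / (?F + ?G) * (cmod (f i) / ?F) = cmod (f i) / (?F + ?G)"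
        "?G / (?F + ?G) * (cmod (g i) / ?G) = cmod (g i) / (?F + ?G)"
        using 3 by simp_all
      then have e: "(?F + ?G) * ((1 - t) * (cmod (f i) / ?F) + t * (cmod (g i) / ?G)) = cmod (f i) + cmod (g i)"
        unfolding t(3) unfolding t_def using S by (simp add: add_divide_distrib[symmetric])
      have "cmod (f i + g i) powr p \<le> (cmod (f i) + cmod (g i)) powr p"
        using assms by (intro powr_mono2 norm_triangle_ineq) auto
      also have "\<dots> = (?F + ?G) powr p * ((1 - t) * (cmod (f i) / ?F) + t * (cmod (g i) / ?G)) powr p"
        unfolding e[symmetric] using 3 t by (subst powr_mult) auto
      also have "\<dots> \<le> (?F + ?G) powr p * ((1 - t) * (cmod (f i) / ?F) powr p + t * (cmod (g i) / ?G) powr p)"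
        using assms 3 t by (intro mult_left_mono powr_convex_combination) auto
      finally show ?thesis using 3 by (simp add: powr_divide)
    qed
    then have "(\<Sum>i\<in>A. cmod (f i + g i) powr p)
        \<le> (\<Sum>i\<in>A. (?F + ?G) powr p * ((1 - t) * (cmod (f i) powr p / ?F powr p) + t * (cmod (g i) powr p / ?G powr p)))"
      by (rule sum_mono)
    also have "\<dots> = (?F + ?G) powr p * ((1 - t) * ((\<Sum>i\<in>A. cmod (f i) powr p) / ?F powr p)
        + t * ((\<Sum>i\<in>A. cmod (g i) powr p) / ?G powr p))"
      by (simp only: sum_distrib_left[symmetric] sum.distrib sum_divide_distrib[symmetric])
    also have "\<dots> = (?F + ?G) powr p"
      using 3 by (simp add: lpn_powr[OF assms(1), symmetric])
    finally show ?thesis using assms by (subst lpn_le_iff) auto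
  qed
qed

lemma lpn_sum_le:
  assumes "1 < p" "finite A" "finite B"
  shows "lpn p A (\<lambda>i. \<Sum>j\<in>B. f j i) \<le> (\<Sum>j\<in>B. lpn p A (f j))"
  using assms(3)
proof induction
  case empty
  then show ?case using lpn_zero_iff[OF assms(1,2), of "\<lambda>_. 0"] by simp
next
  case (insert b B)
  then show ?case
    using lpn_triangle[OF assms(1,2), of "f b" "\<lambda>i. \<Sum>j\<in>B. f j i"] by simp
qed

text \<open>Slicing along the second index: for pairs (i, k) in
  \<open>{..<n} \<times> {..<d}\<close> it separates the d coordinates, each of which a scalar
  matrix transforms on its own.\<close>

lemma lpn_Times_powr:
  assumes "1 < p" "finite A" "finite B"
  shows "lpn p (A \<times> B) f powr p = (\<Sum>j\<in>B. lpn p A (\<lambda>i. f (i, j)) powr p)"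
proof -
  have "(\<Sum>x\<in>A \<times> B. cmod (f x) powr p) = (\<Sum>j\<in>B. \<Sum>i\<in>A. cmod (f (i, j)) powr p)"
    by (subst sum.swap) (simp add: sum.cartesian_product)
  then show ?thesis by (simp add: lpn_powr[OF assms(1)])
qed

lemma lpn_Times_powr_left:
  assumes "1 < p" "finite A" "finite B"
  shows "lpn p (A \<times> B) f powr p = (\<Sum>i\<in>A. lpn p B (\<lambda>j. f (i, j)) powr p)"
  using assms by (simp add: lpn_powr sum.cartesian_product)


section \<open>Matrices as operators between finite-dimensional \<open>\<ell>\<^sub>p\<close> spaces\<close>

definition mapply :: "'j set \<Rightarrow> ('i \<Rightarrow> 'j \<Rightarrow> complex) \<Rightarrow> ('j \<Rightarrow> complex) \<Rightarrow> 'i \<Rightarrow> complex" where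
  "mapply B a \<xi> = (\<lambda>i. \<Sum>j\<in>B. a i j * \<xi> j)"

definition opnorm :: "real \<Rightarrow> 'i set \<Rightarrow> 'j set \<Rightarrow> ('i \<Rightarrow> 'j \<Rightarrow> complex) \<Rightarrow> real" where
  "opnorm p A B a = (SUP \<xi>\<in>{\<xi>. lpn p B \<xi> \<le> 1}. lpn p A (mapply B a \<xi>))"

lemma opnorm_cong:
  assumes "\<And>i j. i \<in> A \<Longrightarrow> j \<in> B \<Longrightarrow> a i j = b i j"
  shows "opnorm p A B a = opnorm p A B b"
  unfolding opnorm_def mapply_def using assms by (intro SUP_cong refl lpn_cong sum.cong) auto

lemma mapply_scale: "mapply B a (\<lambda>j. c * \<xi> j) = (\<lambda>i. c * mapply B a \<xi> i)"
  by (simp add: mapply_def sum_distrib_left mult.left_commute)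

locale lp_index =
  fixes p :: real and A :: "'i set" and B :: "'j set"
  assumes p1: "1 < p" and finA: "finite A" and finB: "finite B"
begin

text \<open>On the unit ball every coordinate of \<xi> has modulus at most 1, so the sum of the
  column norms is a bound. Without a bound the real \<open>SUP\<close> would carry no
  information.\<close>

lemma bdd_opnorm: "bdd_above ((\<lambda>\<xi>. lpn p A (mapply B a \<xi>)) ` {\<xi>. lpn p B \<xi> \<le> 1})"
proof (rule bdd_aboveI2)
  fix \<xi> assume "\<xi> \<in> {\<xi>. lpn p B \<xi> \<le> 1}"
  then have "cmod (\<xi> j) \<le> 1" if "j \<in> B" for j
    using coord_le_lpn[OF p1 finB that, of \<xi>] by simp
  then have "(\<Sum>j\<in>B. lpn p A (\<lambda>i. \<xi> j * a i j)) \<le> (\<Sum>j\<in>B. lpn p A (\<lambda>i. a i j))"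
    by (intro sum_mono) (simp add: lpn_scale[OF p1] mult_left_le_one_le)
  then show "lpn p A (mapply B a \<xi>) \<le> (\<Sum>j\<in>B. lpn p A (\<lambda>i. a i j))"
    using lpn_sum_le[OF p1 finA finB, of "\<lambda>j i. \<xi> j * a i j"] by (simp add: mapply_def mult.commute)
qed

lemma lpn_mapply_le: "lpn p A (mapply B a \<xi>) \<le> opnorm p A B a * lpn p B \<xi>"
proof (cases "lpn p B \<xi> = 0")
  case True
  then have "mapply B a \<xi> = (\<lambda>_. 0)"
    using lpn_zero_iff[OF p1 finB, of \<xi>] by (simp add: mapply_def)
  then show ?thesis using lpn_zero_iff[OF p1 finA, of "\<lambda>_. 0"] True by simp
next
  case False
  then have pos: "0 < lpn p B \<xi>" using lpn_nonneg[of p B \<xi>] by linarith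
  define c where "c = complex_of_real (1 / lpn p B \<xi>)"
  have c: "cmod c * lpn p B \<xi> = 1" using pos by (simp add: c_def norm_divide)
  have "lpn p A (mapply B a (\<lambda>j. c * \<xi> j)) \<le> opnorm p A B a"
    unfolding opnorm_def
    by (rule cSUP_upper[OF _ bdd_opnorm]) (simp add: lpn_scale[OF p1] c)
  then have "cmod c * lpn p A (mapply B a \<xi>) \<le> opnorm p A B a"
    by (simp only: mapply_scale lpn_scale[OF p1])
  then show ?thesis using pos by (simp add: c_def norm_divide field_simps)
qed

lemma opnorm_le:
  assumes "0 \<le> C" "\<And>\<xi>. lpn p A (mapply B a \<xi>) \<le> C * lpn p B \<xi>"
  shows "opnorm p A B a \<le> C"
  unfolding opnorm_def
proof (rule cSUP_least)
  show "{\<xi>. lpn p B \<xi> \<le> 1} \<noteq> {}"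
    using lpn_zero_iff[OF p1 finB, of "\<lambda>_. 0"] by (auto intro!: exI[of _ "\<lambda>_. 0"])
  fix \<xi> assume "\<xi> \<in> {\<xi>. lpn p B \<xi> \<le> 1}"
  then show "lpn p A (mapply B a \<xi>) \<le> C"
    using assms(2)[of \<xi>] mult_left_mono[OF _ assms(1), of "lpn p B \<xi>" 1] by simp
qed

lemma opnorm_nonneg: "0 \<le> opnorm p A B a"
proof -
  have "lpn p A (mapply B a (\<lambda>_. 0)) \<le> opnorm p A B a"
    unfolding opnorm_def
    by (rule cSUP_upper[OF _ bdd_opnorm]) (use lpn_zero_iff[OF p1 finB, of "\<lambda>_. 0"] in simp)
  then show ?thesis using lpn_nonneg[of p A] order_trans by blast
qed

text \<open>One inequality suffices: applied to 1 / c and the scaled matrix it gives the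
  converse.\<close>

lemma opnorm_scale: "opnorm p A B (\<lambda>i j. c * a i j) = cmod c * opnorm p A B a"
proof -
  have le: "opnorm p A B (\<lambda>i j. c * a i j) \<le> cmod c * opnorm p A B a" for c a
  proof (rule opnorm_le)
    fix \<xi>
    have "mapply B (\<lambda>i j. c * a i j) \<xi> = (\<lambda>i. c * mapply B a \<xi> i)"
      by (simp add: mapply_def sum_distrib_left mult.assoc)
    then show "lpn p A (mapply B (\<lambda>i j. c * a i j) \<xi>) \<le> cmod c * opnorm p A B a * lpn p B \<xi>"
      using mult_left_mono[OF lpn_mapply_le[of a \<xi>], of "cmod c"] by (simp add: lpn_scale[OF p1] mult.assoc)
  qed (simp add: opnorm_nonneg)
  show ?thesis
  proof (cases "c = 0")
    case True
    then show ?thesis using le[of c a] opnorm_nonneg[of "\<lambda>i j. c * a i j"] by simp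
  next
    case False
    then show ?thesis
      using le[of c a] le[of "1 / c" "\<lambda>i j. c * a i j"] by (simp add: norm_divide field_simps)
  qed
qed

lemma opnorm_triangle:
  "opnorm p A B (\<lambda>i j. a i j + b i j) \<le> opnorm p A B a + opnorm p A B b"
proof (rule opnorm_le)
  fix \<xi>
  have "lpn p A (mapply B (\<lambda>i j. a i j + b i j) \<xi>)
      \<le> lpn p A (mapply B a \<xi>) + lpn p A (mapply B b \<xi>)"
    using lpn_triangle[OF p1 finA, of "mapply B a \<xi>" "mapply B b \<xi>"]
    by (simp add: mapply_def distrib_right sum.distrib)
  also have "\<dots> \<le> (opnorm p A B a + opnorm p A B b) * lpn p B \<xi>"
    using lpn_mapply_le[of a \<xi>] lpn_mapply_le[of b \<xi>] by (simp add: distrib_right)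
  finally show "lpn p A (mapply B (\<lambda>i j. a i j + b i j) \<xi>) \<le> (opnorm p A B a + opnorm p A B b) * lpn p B \<xi>" .
qed (simp add: opnorm_nonneg)

lemma opnorm_zero_iff: "opnorm p A B a = 0 \<longleftrightarrow> (\<forall>i\<in>A. \<forall>j\<in>B. a i j = 0)"
proof
  assume z: "opnorm p A B a = 0"
  show "\<forall>i\<in>A. \<forall>j\<in>B. a i j = 0"
  proof (intro ballI)
    fix i j assume ij: "i \<in> A" "j \<in> B"
    \<comment> \<open>The unit vector at \<open>j\<close> extracts column \<open>j\<close>.\<close>
    have "lpn p A (mapply B a (\<lambda>k. if k = j then 1 else 0)) = 0"
      using lpn_mapply_le[of a "\<lambda>k. if k = j then 1 else 0"] z lpn_nonneg[of p A] by (simp add: antisym)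
    then show "a i j = 0"
      using ij finB by (simp add: lpn_zero_iff[OF p1 finA] mapply_def if_distrib cong: if_cong)
  qed
next
  assume "\<forall>i\<in>A. \<forall>j\<in>B. a i j = 0"
  then have "opnorm p A B a \<le> 0"
    by (intro opnorm_le) (auto simp: mapply_def lpn_def)
  then show "opnorm p A B a = 0" using opnorm_nonneg[of a] by simp
qed

end


section \<open>Column spaces over subspaces of \<open>\<ell>\<^sub>p\<^sup>d\<close>\<close>

text \<open>Vectors are functions on \<open>nat\<close> of which the norm sees the first
  \<open>d\<close> values only; the elements of \<open>S\<close> are meant to vanish from
  \<open>d\<close> on, as \<open>lp_subspace\<close> requires.\<close>

definition lp_space :: "real \<Rightarrow> nat \<Rightarrow> (nat \<Rightarrow> complex) set \<Rightarrow> (nat \<Rightarrow> complex) cspace" where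
  "lp_space p d S = \<lparr>carr = S, scl = fun_scale, nrm = lpn p {..<d}\<rparr>"

text \<open>An n x n matrix over l_p^d as a scalar matrix with nd rows and n columns: the coordinate
  index \<open>k\<close> of an entry becomes part of the row index.\<close>

abbreviation entries :: "(nat \<Rightarrow> complex) mat \<Rightarrow> nat \<times> nat \<Rightarrow> nat \<Rightarrow> complex" where
  "entries u \<equiv> \<lambda>(i, k) j. (u $$ (i, j)) k"

text \<open>The matrix norms come from identifying \<open>x \<in> S\<close> with the operator \<open>\<complex> \<rightarrow> S\<close>, \<open>c \<mapsto> c x\<close>.\<close>

definition col_space :: "real \<Rightarrow> nat \<Rightarrow> (nat \<Rightarrow> complex) set \<Rightarrow> (nat \<Rightarrow> complex) pspace" where
  "col_space p d S = \<lparr>carr = S, scl = fun_scale, nrm = lpn p {..<d},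
     mnrm = (\<lambda>n u. opnorm p ({..<n} \<times> {..<d}) {..<n} (entries u))\<rparr>"

lemma lp_space_simps [simp]:
  "carr (lp_space p d S) = S" "scl (lp_space p d S) = fun_scale" "nrm (lp_space p d S) = lpn p {..<d}"
  by (simp_all add: lp_space_def)

lemma col_space_simps [simp]:
  "carr (col_space p d S) = S" "scl (col_space p d S) = fun_scale" "nrm (col_space p d S) = lpn p {..<d}"
  "mnrm (col_space p d S) n u = opnorm p ({..<n} \<times> {..<d}) {..<n} (entries u)"
  by (simp_all add: col_space_def)

lemma sum_fun_apply: "(\<Sum>x\<in>A. f x) c = (\<Sum>x\<in>A. f x c)"
  for f :: "'a \<Rightarrow> 'b \<Rightarrow> 'c::comm_monoid_add"
  by (induction A rule: infinite_finite_induct) auto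

lemma sum_lessThan_add: "(\<Sum>i<n + m. g i) = (\<Sum>i<n. g i) + (\<Sum>i<m. g (n + i))"
  for g :: "nat \<Rightarrow> 'a::comm_monoid_add"
  by (induction m) (auto simp: add.assoc)

lemma lp_norm_vec_cmod: "lp_norm p cmod (Matrix.vec n f) = lpn p {..<n} f"
  by (simp add: lp_norm_def lpn_def)

text \<open>Taking p-th powers cancels the inner roots, so the norm of l_p^n(l_p^d) is the l_p norm
  over all pairs (i, k).\<close>

lemma lp_norm_lpn:
  assumes "1 < p" "dim_vec x = n"
  shows "lp_norm p (lpn p {..<d}) x = lpn p ({..<n} \<times> {..<d}) (\<lambda>(i, k). vec_index x i k)"
  using assms by (simp add: lp_norm_def lpn_powr) (simp add: lpn_def sum.cartesian_product split_beta)

text \<open>Functions replace vectors of fixed length: truncation maps the functions of norm at most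
  1 onto the unit ball of vectors, and values beyond the range affect neither side.\<close>

lemma scalar_mat_norm_eq:
  "scalar_mat_norm p \<alpha> = opnorm p {..<dim_row \<alpha>} {..<dim_col \<alpha>} (\<lambda>i j. \<alpha> $$ (i, j))"
proof -
  let ?g = "\<lambda>x. lp_norm p cmod (\<alpha> *\<^sub>v x)"
  have g: "?g (Matrix.vec (dim_col \<alpha>) \<xi>)
      = lpn p {..<dim_row \<alpha>} (mapply {..<dim_col \<alpha>} (\<lambda>i j. \<alpha> $$ (i, j)) \<xi>)" for \<xi>
    by (simp add: mult_mat_vec_def lp_norm_def lpn_def mapply_def scalar_prod_def lessThan_atLeast0)
  have "{x \<in> carrier_vec (dim_col \<alpha>). lp_norm p cmod x \<le> 1}
      = Matrix.vec (dim_col \<alpha>) ` {\<xi>. lpn p {..<dim_col \<alpha>} \<xi> \<le> 1}"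
  proof (intro equalityI subsetI)
    fix x assume x: "x \<in> {x \<in> carrier_vec (dim_col \<alpha>). lp_norm p cmod x \<le> 1}"
    then have "x = Matrix.vec (dim_col \<alpha>) (vec_index x)" by auto
    then show "x \<in> Matrix.vec (dim_col \<alpha>) ` {\<xi>. lpn p {..<dim_col \<alpha>} \<xi> \<le> 1}"
      using x lp_norm_vec_cmod[of p "dim_col \<alpha>" "vec_index x"] by auto
  qed (auto simp: lp_norm_vec_cmod)
  then show ?thesis
    by (simp add: scalar_mat_norm_def opnorm_def image_image g)
qed

lemma mats_col_space:
  "u \<in> mats n (col_space p d S) \<longleftrightarrow>
     u \<in> carrier_mat n n \<and> (\<forall>i<n. \<forall>j<n. u $$ (i, j) \<in> S)"
proof (cases "u \<in> carrier_mat n n")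
  case True
  have "elements_mat u \<subseteq> S \<longleftrightarrow> (\<forall>i<n. \<forall>j<n. u $$ (i, j) \<in> S)"
    using True elements_matI[OF True] by (auto dest!: elements_matD)
  then show ?thesis using True by (simp add: mats_def)
qed (simp add: mats_def)

text \<open>Closedness is phrased through coordinatewise limits in \<open>lim\<close>; on functions
  supported in the first \<open>d\<close> coordinates this is norm convergence, so completeness and
  closedness can both be read off from it.\<close>

locale lp_subspace =
  fixes p :: real and d :: nat and S :: "(nat \<Rightarrow> complex) set"
  assumes p1: "1 < p"
    and supp: "\<And>x i. x \<in> S \<Longrightarrow> d \<le> i \<Longrightarrow> x i = 0"
    and zero: "0 \<in> S"
    and add: "\<And>x y. x \<in> S \<Longrightarrow> y \<in> S \<Longrightarrow> x + y \<in> S"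
    and scale: "\<And>c x. x \<in> S \<Longrightarrow> fun_scale c x \<in> S"
    and lim: "\<And>s l. range s \<subseteq> S \<Longrightarrow> (\<And>i. (\<lambda>n. s n i) \<longlonglongrightarrow> l i) \<Longrightarrow> l \<in> S"
begin

section \<open>Banach space structure of closed subspaces of l_p^d\<close>

lemma lp_index_square: "lp_index p ({..<n} \<times> {..<d}) {..<n}" for n :: nat
  using p1 by unfold_locales auto

lemma lpn_eq_0: "x \<in> S \<Longrightarrow> lpn p {..<d} x = 0 \<longleftrightarrow> x = 0"
  using supp[of x] lpn_zero_iff[OF p1, of "{..<d}" x] by (auto simp: fun_eq_iff not_less[symmetric])

lemma norm_on_lpn: "norm_on S fun_scale 0 (lpn p {..<d})"
  unfolding norm_on_def
  using lpn_eq_0 lpn_scale[OF p1, of "{..<d}"] lpn_triangle[OF p1, of "{..<d}"]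
  by (auto simp: fun_scale_def plus_fun_def)

lemma lpn_diff_tendsto:
  assumes "\<And>i. (\<lambda>n. s n i) \<longlonglongrightarrow> l i"
  shows "(\<lambda>n. lpn p {..<d} (s n - l)) \<longlonglongrightarrow> 0"
proof -
  have "(\<lambda>n. cmod (s n i - l i)) \<longlonglongrightarrow> 0" for i
    using assms[of i] by (simp add: LIM_zero tendsto_norm_zero)
  then have "(\<lambda>n. cmod (s n i - l i) powr p) \<longlonglongrightarrow> 0 powr p" for i
    using p1 by (intro tendsto_powr') auto
  then have "(\<lambda>n. \<Sum>i<d. cmod (s n i - l i) powr p) \<longlonglongrightarrow> (\<Sum>i<d. 0 powr p)"
    by (intro tendsto_sum)
  then have "(\<lambda>n. (\<Sum>i<d. cmod (s n i - l i) powr p) powr (1 / p)) \<longlonglongrightarrow> 0 powr (1 / p)"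
    using p1 by (intro tendsto_powr') (auto intro!: always_eventually sum_nonneg)
  then show ?thesis by (simp add: lpn_def)
qed

text \<open>Each coordinate is dominated by the norm, hence Cauchy; from \<open>d\<close> on the
  sequence is constantly 0. The coordinatewise limit lies in \<open>S\<close> by \<open>lim\<close>,
  and it is a limit in norm because only finitely many coordinates count.\<close>

lemma complete_lpn: "complete_in S (lpn p {..<d})"
  unfolding complete_in_def
proof (intro allI impI)
  fix s :: "nat \<Rightarrow> nat \<Rightarrow> complex"
  assume s: "range s \<subseteq> S"
    and cau: "\<forall>e>0. \<exists>k. \<forall>m\<ge>k. \<forall>n\<ge>k. lpn p {..<d} (s m - s n) < e"
  have conv: "convergent (\<lambda>n. s n i)" for i
  proof (cases "i < d")
    case True
    have "cmod (s m i - s n i) \<le> lpn p {..<d} (s m - s n)" for m n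
      using coord_le_lpn[OF p1, of "{..<d}" i "s m - s n"] True by simp
    then have "Cauchy (\<lambda>n. s n i)"
      using cau by (intro CauchyI) (meson le_less_trans)
    then show ?thesis by (rule Cauchy_convergent)
  next
    case False
    then have "s n i = 0" for n using s supp[of "s n" i] by auto
    then show ?thesis by (simp add: convergent_const)
  qed
  define l where "l i = Topological_Spaces.lim (\<lambda>n. s n i)" for i
  have "(\<lambda>n. s n i) \<longlonglongrightarrow> l i" for i
    using conv[of i] by (simp add: l_def convergent_LIMSEQ_iff)
  then show "\<exists>l\<in>S. (\<lambda>n. lpn p {..<d} (s n - l)) \<longlonglongrightarrow> 0"
    using lim[OF s] lpn_diff_tendsto by blast
qed

lemma vector_space_fun_scale: "vector_space (fun_scale :: complex \<Rightarrow> ('m \<Rightarrow> complex) \<Rightarrow> _)"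
  by unfold_locales (auto simp: fun_scale_def fun_eq_iff algebra_simps)

text \<open>Stated through the record components so that it serves both \<open>lp_space\<close> and
  \<open>col_space\<close>.\<close>

lemma banach_space_lp:
  assumes "carr X = S" "scl X = fun_scale" "nrm X = lpn p {..<d}"
  shows "banach_space X"
proof -
  interpret vs: vector_space "fun_scale :: complex \<Rightarrow> (nat \<Rightarrow> complex) \<Rightarrow> _"
    by (rule vector_space_fun_scale)
  have "module.subspace fun_scale S"
    unfolding vs.subspace_def using zero add scale by auto
  then show ?thesis
    unfolding banach_space_def assms
    using vs.vector_space_axioms norm_on_lpn complete_lpn by blast
qed

text \<open>Approximants within 1 / (n + 1) converge to \<open>x\<close> in each of the first
  \<open>d\<close> coordinates, and from \<open>d\<close> on everything vanishes; so
  \<open>lim\<close> applies.\<close>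

lemma closed_in_lpn:
  assumes "S \<subseteq> T" and T: "\<And>x i. x \<in> T \<Longrightarrow> d \<le> i \<Longrightarrow> x i = 0"
  shows "closed_in T (lpn p {..<d}) S"
  unfolding closed_in_def
proof (intro conjI assms ballI impI)
  fix x assume x: "x \<in> T" and "\<forall>e>0. \<exists>y\<in>S. lpn p {..<d} (x - y) < e"
  then have "\<exists>y\<in>S. lpn p {..<d} (x - y) < 1 / real (Suc n)" for n by simp
  then obtain s where s: "s n \<in> S" "lpn p {..<d} (x - s n) < 1 / real (Suc n)" for n
    by metis
  have "(\<lambda>n. s n i) \<longlonglongrightarrow> x i" for i
  proof (cases "i < d")
    case True
    have "norm (s n i - x i) \<le> 1 / real (Suc n)" for n
      using coord_le_lpn[OF p1, of "{..<d}" i "x - s n"] s(2)[of n] True by (simp add: norm_minus_commute)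
    then have "(\<lambda>n. s n i - x i) \<longlonglongrightarrow> 0"
      by (intro Lim_null_comparison[OF always_eventually LIMSEQ_Suc[OF lim_1_over_n]]) simp
    then show ?thesis by (rule LIM_zero_cancel)
  next
    case False
    then show ?thesis using T[OF x, of i] supp[OF s(1), of i] by simp
  qed
  then show "x \<in> S" using s(1) by (intro lim[where s=s]) auto
qed

section \<open>The axioms of a p-operator space for column spaces\<close>

lemma mnrm_norm_on:
  "norm_on (mats n (col_space p d S)) (\<lambda>c. map_mat (scl (col_space p d S) c)) (0\<^sub>m n n)
     (mnrm (col_space p d S) n)"
proof -
  interpret lp_index p "{..<n} \<times> {..<d}" "{..<n}" by (rule lp_index_square)
  let ?N = "\<lambda>u. opnorm p ({..<n} \<times> {..<d}) {..<n} (entries u)"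
  have zero_iff: "?N u = 0 \<longleftrightarrow> u = 0\<^sub>m n n" if u: "u \<in> mats n (col_space p d S)" for u
  proof
    assume "?N u = 0"
    then have "(u $$ (i, j)) k = 0" if "i < n" "j < n" for i j k
      using that u supp[of "u $$ (i, j)" k] by (cases "k < d") (auto simp: opnorm_zero_iff mats_col_space)
    then show "u = 0\<^sub>m n n"
      using u by (intro eq_matI) (auto simp: mats_col_space fun_eq_iff)
  qed (simp add: opnorm_zero_iff)
  have scale': "?N (map_mat (fun_scale c) u) = cmod c * ?N u" if u: "u \<in> mats n (col_space p d S)" for c u
    unfolding opnorm_scale[symmetric]
    by (rule opnorm_cong) (use u in \<open>auto simp: mats_col_space fun_scale_def\<close>)
  have add': "?N (u + v) \<le> ?N u + ?N v"
    if "u \<in> mats n (col_space p d S)" "v \<in> mats n (col_space p d S)" for u v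
  proof -
    have "?N (u + v) = opnorm p ({..<n} \<times> {..<d}) {..<n} (\<lambda>a j. entries u a j + entries v a j)"
      by (rule opnorm_cong) (use that in \<open>auto simp: mats_col_space\<close>)
    then show ?thesis using opnorm_triangle[of "entries u" "entries v"] by simp
  qed
  show ?thesis
    unfolding norm_on_def using opnorm_nonneg zero_iff scale' add' by simp
qed

text \<open>The 1 x 1 matrix with entry \<open>x\<close> acts as c |-> c x, which multiplies every
  norm by exactly the norm of \<open>x\<close>; the input 1 shows that this factor is
  attained.\<close>

lemma mnrm_1: "opnorm p ({..<1} \<times> {..<d}) {..<1::nat} (entries (mat 1 1 (\<lambda>_. x))) = lpn p {..<d} x"
proof -
  interpret lp_index p "{..<1::nat} \<times> {..<d}" "{..<1::nat}" by (rule lp_index_square)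
  have one: "lpn p ({..<1::nat} \<times> {..<d}) f = lpn p {..<d} (\<lambda>k. f (0, k))" for f
  proof -
    have "(\<Sum>x\<in>{..<1::nat} \<times> {..<d}. cmod (f x) powr p) = (\<Sum>i<1. \<Sum>k<d. cmod (f (i, k)) powr p)"
      by (simp add: sum.cartesian_product split_beta del: lessThan_Suc lessThan_0)
    then show ?thesis by (simp add: lpn_def)
  qed
  have ap: "lpn p ({..<1} \<times> {..<d}) (mapply {..<1::nat} (entries (mat 1 1 (\<lambda>_. x))) \<xi>)
      = lpn p {..<d} x * lpn p {..<1::nat} \<xi>" for \<xi>
  proof -
    have "lpn p {..<1::nat} \<xi> = cmod (\<xi> 0)"
      using p1 by (simp add: lpn_def powr_powr)
    moreover have "lpn p ({..<1} \<times> {..<d}) (mapply {..<1::nat} (entries (mat 1 1 (\<lambda>_. x))) \<xi>)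
        = lpn p {..<d} (\<lambda>k. \<xi> 0 * x k)"
      by (simp only: one) (simp add: mapply_def mult.commute)
    ultimately show ?thesis by (simp add: lpn_scale[OF p1] mult.commute)
  qed
  have "lpn p {..<d} x * lpn p {..<1::nat} (\<lambda>_. 1)
      \<le> opnorm p ({..<1} \<times> {..<d}) {..<1::nat} (entries (mat 1 1 (\<lambda>_. x))) * lpn p {..<1::nat} (\<lambda>_. 1)"
    using lpn_mapply_le[of "entries (mat 1 1 (\<lambda>_. x))" "\<lambda>_. 1"] unfolding ap .
  moreover have "lpn p {..<1::nat} (\<lambda>_. 1) = 1" by (simp add: lpn_def)
  ultimately show ?thesis
    using opnorm_le[of "lpn p {..<d} x" "entries (mat 1 1 (\<lambda>_. x))"] ap by simp
qed

lemma powr_le_cancel: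
  assumes "0 \<le> a" "0 \<le> b" "a powr p \<le> b powr p"
  shows "a \<le> b"
  using assms p1 powr_less_mono2[of p b a] by (auto simp: not_le[symmetric])

text \<open>Input and output both split into two blocks whose p-th powers add, which gives the upper
  bound by the maximum. Padding an input of one block with zeros gives the two lower bounds.\<close>

lemma mnrm_direct_sum:
  assumes "u \<in> mats n (col_space p d S)" "v \<in> mats m (col_space p d S)"
  shows "mnrm (col_space p d S) (n + m) (direct_sum u v)
       = max (mnrm (col_space p d S) n u) (mnrm (col_space p d S) m v)"
proof -
  interpret n: lp_index p "{..<n} \<times> {..<d}" "{..<n}" by (rule lp_index_square)
  interpret m: lp_index p "{..<m} \<times> {..<d}" "{..<m}" by (rule lp_index_square)
  interpret nm: lp_index p "{..<n + m} \<times> {..<d}" "{..<n + m}" by (rule lp_index_square)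
  let ?u = "opnorm p ({..<n} \<times> {..<d}) {..<n} (entries u)"
  let ?v = "opnorm p ({..<m} \<times> {..<d}) {..<m} (entries v)"
  let ?w = "opnorm p ({..<n + m} \<times> {..<d}) {..<n + m} (entries (direct_sum u v))"
  have dims: "dim_row u = n" "dim_col u = n" "dim_row v = m" "dim_col v = m"
    using assms by (auto simp: mats_col_space)
  have ap1: "mapply {..<n + m} (entries (direct_sum u v)) \<xi> (i, k) = mapply {..<n} (entries u) \<xi> (i, k)"
    if "i < n" for i k \<xi>
    using that dims by (simp add: mapply_def direct_sum_def sum_lessThan_add)
  have ap2: "mapply {..<n + m} (entries (direct_sum u v)) \<xi> (n + i, k)
      = mapply {..<m} (entries v) (\<lambda>j. \<xi> (n + j)) (i, k)" if "i < m" for i k \<xi>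
    using that dims by (simp add: mapply_def direct_sum_def sum_lessThan_add)
  have split1: "lpn p {..<n + m} \<xi> powr p = lpn p {..<n} \<xi> powr p + lpn p {..<m} (\<lambda>j. \<xi> (n + j)) powr p" for \<xi>
    by (simp add: lpn_powr[OF p1] sum_lessThan_add)
  have split2: "lpn p ({..<n + m} \<times> {..<d}) (mapply {..<n + m} (entries (direct_sum u v)) \<xi>) powr p
     = lpn p ({..<n} \<times> {..<d}) (mapply {..<n} (entries u) \<xi>) powr p
       + lpn p ({..<m} \<times> {..<d}) (mapply {..<m} (entries v) (\<lambda>j. \<xi> (n + j))) powr p" for \<xi>
    by (simp add: lpn_Times_powr_left[OF p1] sum_lessThan_add ap1 ap2)
  have "?w \<le> max ?u ?v"
  proof (rule nm.opnorm_le)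
    fix \<xi> :: "nat \<Rightarrow> complex"
    let ?a = "lpn p {..<n} \<xi>" and ?b = "lpn p {..<m} (\<lambda>j. \<xi> (n + j))"
    have "lpn p ({..<n} \<times> {..<d}) (mapply {..<n} (entries u) \<xi>) \<le> max ?u ?v * ?a"
      by (rule order_trans[OF n.lpn_mapply_le]) (simp add: mult_right_mono)
    moreover have "lpn p ({..<m} \<times> {..<d}) (mapply {..<m} (entries v) (\<lambda>j. \<xi> (n + j))) \<le> max ?u ?v * ?b"
      by (rule order_trans[OF m.lpn_mapply_le]) (simp add: mult_right_mono)
    ultimately have "lpn p ({..<n + m} \<times> {..<d}) (mapply {..<n + m} (entries (direct_sum u v)) \<xi>) powr p
        \<le> (max ?u ?v * ?a) powr p + (max ?u ?v * ?b) powr p"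
      unfolding split2 using p1 by (intro add_mono powr_mono2) auto
    also have "\<dots> = (max ?u ?v * lpn p {..<n + m} \<xi>) powr p"
      using n.opnorm_nonneg[of "entries u"] by (simp add: powr_mult split1 distrib_left le_max_iff_disj)
    finally show "lpn p ({..<n + m} \<times> {..<d}) (mapply {..<n + m} (entries (direct_sum u v)) \<xi>)
        \<le> max ?u ?v * lpn p {..<n + m} \<xi>"
      using n.opnorm_nonneg[of "entries u"] by - (rule powr_le_cancel, auto simp: le_max_iff_disj)
  qed (simp add: n.opnorm_nonneg le_max_iff_disj)
  moreover have "?u \<le> ?w"
  proof (rule n.opnorm_le)
    fix \<xi> :: "nat \<Rightarrow> complex"
    define \<eta> :: "nat \<Rightarrow> complex" where "\<eta> i = (if i < n then \<xi> i else 0)" for i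
    have "mapply {..<n} (entries u) \<eta> = mapply {..<n} (entries u) \<xi>"
      by (auto simp: mapply_def \<eta>_def fun_eq_iff)
    then have "lpn p ({..<n} \<times> {..<d}) (mapply {..<n} (entries u) \<xi>)
        \<le> lpn p ({..<n + m} \<times> {..<d}) (mapply {..<n + m} (entries (direct_sum u v)) \<eta>)"
      using split2[of \<eta>] by - (rule powr_le_cancel, auto)
    also have "\<dots> \<le> ?w * lpn p {..<n + m} \<eta>" by (rule nm.lpn_mapply_le)
    also have "lpn p {..<n + m} \<eta> = lpn p {..<n} \<xi>"
      using p1 by (simp add: lpn_def sum_lessThan_add \<eta>_def)
    finally show "lpn p ({..<n} \<times> {..<d}) (mapply {..<n} (entries u) \<xi>) \<le> ?w * lpn p {..<n} \<xi>" .
  qed (rule nm.opnorm_nonneg)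
  moreover have "?v \<le> ?w"
  proof (rule m.opnorm_le)
    fix \<xi> :: "nat \<Rightarrow> complex"
    define \<eta> :: "nat \<Rightarrow> complex" where "\<eta> i = (if i < n then 0 else \<xi> (i - n))" for i
    have \<eta>: "(\<lambda>j. \<eta> (n + j)) = \<xi>" by (simp add: \<eta>_def)
    have "lpn p ({..<m} \<times> {..<d}) (mapply {..<m} (entries v) \<xi>)
        \<le> lpn p ({..<n + m} \<times> {..<d}) (mapply {..<n + m} (entries (direct_sum u v)) \<eta>)"
      using split2[of \<eta>] unfolding \<eta> by - (rule powr_le_cancel, auto)
    also have "\<dots> \<le> ?w * lpn p {..<n + m} \<eta>" by (rule nm.lpn_mapply_le)
    also have "lpn p {..<n + m} \<eta> = lpn p {..<m} \<xi>"
      using p1 by (simp add: lpn_def sum_lessThan_add \<eta>_def)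
    finally show "lpn p ({..<m} \<times> {..<d}) (mapply {..<m} (entries v) \<xi>) \<le> ?w * lpn p {..<m} \<xi>" .
  qed (rule nm.opnorm_nonneg)
  ultimately show ?thesis by simp
qed

text \<open>The product applies \<open>\<beta>\<close>, then \<open>u\<close>, then
  \<open>\<alpha>\<close> to each of the d coordinate slices. The p-th power of the norm is the sum
  over the slices, so the last step costs no more than the scalar norm of
  \<open>\<alpha>\<close>.\<close>

lemma mnrm_two_sided:
  assumes u: "u \<in> mats m (col_space p d S)" and \<alpha>: "\<alpha> \<in> carrier_mat n m" and \<beta>: "\<beta> \<in> carrier_mat m n"
  shows "mnrm (col_space p d S) n (two_sided_mult fun_scale \<alpha> u \<beta>)
       \<le> scalar_mat_norm p \<alpha> * mnrm (col_space p d S) m u * scalar_mat_norm p \<beta>"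
proof -
  interpret n: lp_index p "{..<n} \<times> {..<d}" "{..<n}" by (rule lp_index_square)
  interpret m: lp_index p "{..<m} \<times> {..<d}" "{..<m}" by (rule lp_index_square)
  interpret A: lp_index p "{..<n}" "{..<m}" using p1 by unfold_locales auto
  interpret B: lp_index p "{..<m}" "{..<n}" using p1 by unfold_locales auto
  let ?a = "\<lambda>i j. \<alpha> $$ (i, j)" and ?b = "\<lambda>i j. \<beta> $$ (i, j)"
  let ?A = "opnorm p {..<n} {..<m} ?a" and ?B = "opnorm p {..<m} {..<n} ?b"
  let ?U = "opnorm p ({..<m} \<times> {..<d}) {..<m} (entries u)"
  have dims: "dim_row u = m" "dim_col u = m" "dim_row \<alpha> = n" "dim_col \<alpha> = m" "dim_row \<beta> = m" "dim_col \<beta> = n"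
    using assms by (auto simp: mats_col_space)
  have "opnorm p ({..<n} \<times> {..<d}) {..<n} (entries (two_sided_mult fun_scale \<alpha> u \<beta>)) \<le> ?A * ?U * ?B"
  proof (rule n.opnorm_le)
    fix \<xi> :: "nat \<Rightarrow> complex"
    \<comment> \<open>The image of \<xi> under \<open>\<beta>\<close> and then \<open>u\<close>,
      indexed by block \<open>q\<close> and coordinate \<open>k\<close>; \<open>\<alpha>\<close>
      acts on \<open>q\<close> with \<open>k\<close> fixed.\<close>
    define w where "w = mapply {..<m} (entries u) (mapply {..<n} ?b \<xi>)"
    have ent: "mapply {..<n} (entries (two_sided_mult fun_scale \<alpha> u \<beta>)) \<xi> (i, k)
        = mapply {..<m} ?a (\<lambda>q. w (q, k)) i" if "i < n" for i k
    proof -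
      have "mapply {..<n} (entries (two_sided_mult fun_scale \<alpha> u \<beta>)) \<xi> (i, k)
          = (\<Sum>j<n. \<Sum>q<m. \<Sum>l<m. \<alpha> $$ (i, q) * \<beta> $$ (l, j) * (u $$ (q, l)) k * \<xi> j)"
        using that dims by (simp add: mapply_def two_sided_mult_def sum_fun_apply fun_scale_def sum_distrib_right)
      also have "\<dots> = (\<Sum>q<m. \<Sum>l<m. \<Sum>j<n. \<alpha> $$ (i, q) * \<beta> $$ (l, j) * (u $$ (q, l)) k * \<xi> j)"
        by (subst sum.swap, rule sum.cong[OF refl], rule sum.swap)
      also have "\<dots> = mapply {..<m} ?a (\<lambda>q. w (q, k)) i"
        by (simp add: mapply_def w_def sum_distrib_left mult_ac)
      finally show ?thesis .
    qed
    have "lpn p ({..<n} \<times> {..<d}) (mapply {..<n} (entries (two_sided_mult fun_scale \<alpha> u \<beta>)) \<xi>) powr p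
        = (\<Sum>k<d. lpn p {..<n} (mapply {..<m} ?a (\<lambda>q. w (q, k))) powr p)"
      by (subst lpn_Times_powr[OF p1]) (auto intro!: sum.cong arg_cong[where f="\<lambda>x. x powr p"] lpn_cong simp: ent)
    also have "\<dots> \<le> (\<Sum>k<d. (?A * lpn p {..<m} (\<lambda>q. w (q, k))) powr p)"
      using p1 by (intro sum_mono powr_mono2 A.lpn_mapply_le) auto
    also have "\<dots> = (?A * lpn p ({..<m} \<times> {..<d}) w) powr p"
      by (simp add: powr_mult A.opnorm_nonneg lpn_Times_powr[OF p1] sum_distrib_left)
    finally have "lpn p ({..<n} \<times> {..<d}) (mapply {..<n} (entries (two_sided_mult fun_scale \<alpha> u \<beta>)) \<xi>)
        \<le> ?A * lpn p ({..<m} \<times> {..<d}) w"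
      by - (rule powr_le_cancel, auto simp: A.opnorm_nonneg)
    also have "\<dots> \<le> ?A * (?U * lpn p {..<m} (mapply {..<n} ?b \<xi>))"
      unfolding w_def by (intro mult_left_mono m.lpn_mapply_le A.opnorm_nonneg)
    also have "\<dots> \<le> ?A * (?U * (?B * lpn p {..<n} \<xi>))"
      by (intro mult_left_mono B.lpn_mapply_le A.opnorm_nonneg m.opnorm_nonneg)
    finally show "lpn p ({..<n} \<times> {..<d}) (mapply {..<n} (entries (two_sided_mult fun_scale \<alpha> u \<beta>)) \<xi>)
        \<le> ?A * ?U * ?B * lpn p {..<n} \<xi>"
      by (simp add: mult.assoc)
  qed (simp add: A.opnorm_nonneg m.opnorm_nonneg B.opnorm_nonneg)
  then show ?thesis by (simp add: scalar_mat_norm_eq dims)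
qed

lemma p_operator_space_col: "p_operator_space p (col_space p d S)"
  unfolding p_operator_space_def
proof (intro conjI)
  show "\<forall>x\<in>carr (col_space p d S). mnrm (col_space p d S) 1 (mat 1 1 (\<lambda>_. x)) = nrm (col_space p d S) x"
    unfolding col_space_simps using mnrm_1 by blast
  show "banach_space (col_space p d S)"
    by (rule banach_space_lp) simp_all
qed (use mnrm_norm_on mnrm_direct_sum mnrm_two_sided in \<open>simp_all del: col_space_simps(4)\<close>)

text \<open>\<open>S\<close> lies in l_p^d, which is L_p of the counting measure on d points of the
  prescribed type; the quotient only identifies functions that agree on these points.\<close>

lemma SQ_p_lp_space: "SQ_p TYPE(real \<Rightarrow> real) p (lp_space p d S)"
proof -
  \<comment> \<open>The d points are the constant functions with values 0, ..., d - 1;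
    \<open>r\<close> recovers the index from the value at 0.\<close>
  define g :: "nat \<Rightarrow> real \<Rightarrow> real" where "g i = (\<lambda>_. real i)" for i
  define r :: "(real \<Rightarrow> real) \<Rightarrow> nat" where "r t = nat \<lfloor>t 0\<rfloor>" for t
  have rg [simp]: "r (g i) = i" for i by (simp add: r_def g_def)
  then have inj: "inj_on g {..<d}" by (metis inj_onI)
  define M where "M = count_space (g ` {..<d})"
  \<comment> \<open>The null functions of \<open>M\<close>. Modulo \<open>K\<close> only the values
    on the atoms matter, so \<open>J x\<close> may take any values elsewhere.\<close>
  define K :: "((real \<Rightarrow> real) \<Rightarrow> complex) set" where "K = {f. \<forall>i<d. f (g i) = 0}"
  define J :: "(nat \<Rightarrow> complex) \<Rightarrow> (real \<Rightarrow> real) \<Rightarrow> complex" where "J x = (\<lambda>t. x (r t))" for x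
  interpret vs: vector_space "fun_scale :: complex \<Rightarrow> ((real \<Rightarrow> real) \<Rightarrow> complex) \<Rightarrow> _"
    by (rule vector_space_fun_scale)
  have Lp: "Lp_fun p M = UNIV"
    by (auto simp: Lp_fun_def M_def integrable_count_space)
  have Ln: "Lp_norm p M f = lpn p {..<d} (\<lambda>i. f (g i))" for f
    by (simp add: Lp_norm_def M_def lpn_def lebesgue_integral_count_space_finite sum.reindex[OF inj])
  have "vs.subspace K"
    unfolding vs.subspace_def by (auto simp: K_def fun_scale_def)
  moreover have "closed_in (Lp_fun p M) (Lp_norm p M) K"
    unfolding closed_in_def Lp
  proof (intro conjI ballI impI)
    fix x :: "(real \<Rightarrow> real) \<Rightarrow> complex"
    assume x: "\<forall>e>0. \<exists>y\<in>K. Lp_norm p M (x - y) < e"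
    have "cmod (x (g i)) \<le> 0 + e" if i: "i < d" and "0 < e" for i e
    proof -
      obtain y where y: "y \<in> K" "Lp_norm p M (x - y) < e" using x \<open>0 < e\<close> by blast
      then show ?thesis
        using coord_le_lpn[OF p1, of "{..<d}" i "\<lambda>i. (x - y) (g i)"] i by (simp add: Ln K_def)
    qed
    then show "x \<in> K" using field_le_epsilon[of "cmod (x (g _))" 0] by (auto simp: K_def)
  qed simp
  moreover have "quotient_norm (Lp_norm p M) K (J x) = lpn p {..<d} x" for x
  proof -
    have "Lp_norm p M (J x - f) = lpn p {..<d} x" if "f \<in> K" for f
      unfolding Ln using that by (intro lpn_cong) (auto simp: J_def K_def)
    moreover have "K \<noteq> {}" by (auto simp: K_def intro!: exI[of _ "\<lambda>_. 0"])
    ultimately show ?thesis by (simp add: quotient_norm_def)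
  qed
  moreover have "banach_space (lp_space p d S)"
    by (rule banach_space_lp) simp_all
  ultimately show ?thesis
    unfolding SQ_p_def
    by (intro conjI exI[of _ M] exI[of _ K] exI[of _ J]) (auto simp: Lp J_def K_def fun_scale_def)
qed

end

section \<open>Maps from column spaces into spaces of operators\<close>

definition rank_one ::
  "(nat \<Rightarrow> complex) set \<Rightarrow> ((nat \<Rightarrow> complex) \<Rightarrow> complex) \<Rightarrow> (nat \<Rightarrow> complex) \<Rightarrow> (nat \<Rightarrow> complex) \<Rightarrow> nat \<Rightarrow> complex" where
  "rank_one S f x = (\<lambda>y. if y \<in> S then fun_scale (f y) x else 0)"

context lp_subspace
begin

text \<open>Applied to a vector (x_j), the operator matrix acts as the scalar matrix of
  \<open>u\<close> on the numbers \<xi>_j = f(x_j), and contractivity of \<open>f\<close> keeps the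
  l_p norm of \<xi> at most that of (x_j). The value 0 off \<open>S\<close> in
  \<open>rank_one\<close> is the normalisation of \<open>bounded_ops\<close>.\<close>

lemma rank_one_completely_contractive:
  assumes f_add: "\<And>x y. x \<in> S \<Longrightarrow> y \<in> S \<Longrightarrow> f (x + y) = f x + f y"
    and f_scale: "\<And>c x. x \<in> S \<Longrightarrow> f (fun_scale c x) = c * f x"
    and f_le: "\<And>x. x \<in> S \<Longrightarrow> cmod (f x) \<le> lpn p {..<d} x"
  shows "p_completely_contractive (col_space p d S) (op_space p (lp_space p d S)) (rank_one S f)"
  unfolding p_completely_contractive_def
proof (intro conjI allI impI ballI)
  have N: "lpn p {..<d} (fun_scale c x) = cmod c * lpn p {..<d} x" for c x
    by (simp add: fun_scale_def lpn_scale[OF p1])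
  have "rank_one S f x \<in> bounded_ops (lp_space p d S)" if "x \<in> S" for x
  proof -
    have "linear_map (lp_space p d S) (lp_space p d S) (rank_one S f x)"
      using that by (simp add: linear_map_def rank_one_def add scale f_add f_scale)
        (simp add: fun_scale_def fun_eq_iff algebra_simps)
    moreover have "\<forall>y\<in>S. lpn p {..<d} (rank_one S f x y) \<le> lpn p {..<d} x * lpn p {..<d} y"
      using mult_right_mono[OF f_le lpn_nonneg[of p "{..<d}" x]] by (simp add: rank_one_def N mult.commute)
    ultimately show ?thesis by (auto simp: bounded_ops_def rank_one_def)
  qed
  then show "linear_map (col_space p d S) (op_space p (lp_space p d S)) (rank_one S f)"
    by (auto simp: linear_map_def op_space_def rank_one_def fun_eq_iff fun_scale_def algebra_simps)
next
  fix n :: nat and u assume u: "u \<in> mats n (col_space p d S)"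
  interpret lp_index p "{..<n} \<times> {..<d}" "{..<n}" by (rule lp_index_square)
  let ?N = "lp_norm p (lpn p {..<d})" and ?U = "opnorm p ({..<n} \<times> {..<d}) {..<n} (entries u)"
  let ?B = "{x \<in> carrier_vec n. set\<^sub>v x \<subseteq> S \<and> ?N x \<le> 1}"
  have "(SUP x\<in>?B. ?N (op_mat_mult (map_mat (rank_one S f) u) x)) \<le> ?U"
  proof (rule cSUP_least)
    have "0\<^sub>v n \<in> ?B"
      using zero p1 by (auto simp: vec_set_def lp_norm_def lpn_def)
    then show "?B \<noteq> {}" by blast
  next
    fix x assume x: "x \<in> ?B"
    then have xS: "vec_index x j \<in> S" if "j < n" for j
      using that by (auto simp: vec_set_def)
    define \<xi> where "\<xi> j = f (vec_index x j)" for j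
    have "(\<Sum>j<n. cmod (\<xi> j) powr p) \<le> (\<Sum>j<n. lpn p {..<d} (vec_index x j) powr p)"
      unfolding \<xi>_def using p1 xS f_le by (intro sum_mono powr_mono2) auto
    then have "lpn p {..<n} \<xi> \<le> ?N x"
      using x p1 unfolding lpn_def[of p "{..<n}"] lp_norm_def
      by (intro powr_mono2) (auto intro!: sum_nonneg)
    then have \<xi>: "lpn p {..<n} \<xi> \<le> 1" using x by simp
    have "?N (op_mat_mult (map_mat (rank_one S f) u) x)
        = lpn p ({..<n} \<times> {..<d}) (mapply {..<n} (entries u) \<xi>)"
      using u x xS by (subst lp_norm_lpn[OF p1, of _ n])
        (auto simp: mats_col_space op_mat_mult_def mapply_def sum_fun_apply rank_one_def fun_scale_def
           \<xi>_def mult.commute intro!: lpn_cong sum.cong)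
    also have "\<dots> \<le> ?U * lpn p {..<n} \<xi>" by (rule lpn_mapply_le)
    also have "\<dots> \<le> ?U" using \<xi> opnorm_nonneg by (simp add: mult_left_le)
    finally show "?N (op_mat_mult (map_mat (rank_one S f) u) x) \<le> ?U" .
  qed
  then show "mnrm (op_space p (lp_space p d S)) n (map_mat (rank_one S f) u) \<le> mnrm (col_space p d S) n u"
    by (simp add: op_space_def)
qed

text \<open>At the first matrix level the norm of \<open>\<psi> x\<close> is its operator norm, and
  \<open>e\<close> is one of the unit ball vectors over which the supremum runs.\<close>

lemma evaluation_contractive:
  assumes \<psi>: "p_completely_contractive (col_space p d T) (op_space p (lp_space p d S)) \<psi>"
    and T: "lp_subspace p d T" and e: "e \<in> S" "lpn p {..<d} e \<le> 1" and x: "x \<in> T"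
  shows "lpn p {..<d} (\<psi> x e) \<le> lpn p {..<d} x"
proof -
  interpret T: lp_subspace p d T by (rule T)
  let ?N = "lp_norm p (lpn p {..<d})" and ?m = "mat 1 1 (\<lambda>_. x)"
  let ?B = "{y \<in> carrier_vec 1. set\<^sub>v y \<subseteq> S \<and> ?N y \<le> 1}"
  let ?F = "\<lambda>y. ?N (op_mat_mult (map_mat \<psi> ?m) y)"
  have N1: "?N y = lpn p {..<d} (vec_index y 0)" if "dim_vec y = 1" for y
    using p1 that by (simp add: lp_norm_def powr_powr)
  have F: "?F y = lpn p {..<d} (\<psi> x (vec_index y 0))" if "y \<in> carrier_vec 1" for y
    using that by (subst N1) (auto simp: op_mat_mult_def)
  have "?m \<in> mats 1 (col_space p d T)" using x by (auto simp: mats_col_space)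
  then have "mnrm (op_space p (lp_space p d S)) 1 (map_mat \<psi> ?m) \<le> mnrm (col_space p d T) 1 ?m"
    using \<psi> unfolding p_completely_contractive_def by blast
  then have le: "(SUP y\<in>?B. ?F y) \<le> lpn p {..<d} x"
    using T.mnrm_1[of x] by (simp add: op_space_def)
  have "\<psi> x \<in> bounded_ops (lp_space p d S)"
    using \<psi> x unfolding p_completely_contractive_def linear_map_def by (simp add: op_space_def)
  then obtain C where C: "\<forall>y\<in>S. lpn p {..<d} (\<psi> x y) \<le> C * lpn p {..<d} y"
    by (auto simp: bounded_ops_def)
  \<comment> \<open>The constant from \<open>bounded_ops\<close> carries no sign, hence the absolute
    value.\<close>
  have bdd: "bdd_above (?F ` ?B)"
  proof (rule bdd_aboveI2)
    fix y assume y: "y \<in> ?B"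
    then have "vec_index y 0 \<in> S" "lpn p {..<d} (vec_index y 0) \<le> 1"
      using N1[of y] by (auto simp: vec_set_def)
    then have "lpn p {..<d} (\<psi> x (vec_index y 0)) \<le> \<bar>C\<bar> * 1"
      using C by (meson abs_ge_self abs_ge_zero lpn_nonneg mult_mono order_trans)
    then show "?F y \<le> \<bar>C\<bar>" using F y by simp
  qed
  have v: "Matrix.vec 1 (\<lambda>_. e) \<in> ?B"
    using e N1[of "Matrix.vec 1 (\<lambda>_. e)"] by (auto simp: vec_set_def)
  have "lpn p {..<d} (\<psi> x e) = ?F (Matrix.vec 1 (\<lambda>_. e))" by (subst F) auto
  also have "\<dots> \<le> (SUP y\<in>?B. ?F y)" by (rule cSUP_upper[OF v bdd])
  finally show ?thesis using le by simp
qed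

end


section \<open>A hyperplane of \<open>\<ell>\<^sub>p\<^sup>3\<close> that is not contractively complemented\<close>

definition coord3 :: "(nat \<Rightarrow> complex) set" where
  "coord3 = {x. \<forall>i\<ge>3. x i = 0}"

definition sum_zero3 :: "(nat \<Rightarrow> complex) set" where
  "sum_zero3 = {x \<in> coord3. (\<Sum>i<3. x i) = 0}"

lemma lp_subspace_T: "1 < p \<Longrightarrow> lp_subspace p 3 coord3"
proof (unfold_locales, goal_cases)
  \<comment> \<open>The sixth goal is \<open>lim\<close>, closedness under coordinatewise
    limits.\<close>
  case (6 s l)
  then have s: "s n \<in> coord3" and l: "(\<lambda>n. s n i) \<longlonglongrightarrow> l i" for n i by auto
  have "l i = 0" if "3 \<le> i" for i
    using l[of i] s that by (simp add: coord3_def tendsto_const_iff)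
  then show ?case by (simp add: coord3_def)
qed (auto simp: coord3_def fun_scale_def)

lemma lp_subspace_S:
  assumes "1 < p"
  shows "lp_subspace p 3 sum_zero3"
proof -
  interpret T: lp_subspace p 3 coord3 by (rule lp_subspace_T[OF assms])
  show ?thesis
  proof (unfold_locales, goal_cases)
    case (6 s l)
    have "s n \<in> sum_zero3" for n using 6 by blast
    then have "s n \<in> coord3" "(\<Sum>i<3. s n i) = 0" for n by (auto simp: sum_zero3_def)
    moreover have "(\<lambda>n. \<Sum>i<3. s n i) \<longlonglongrightarrow> (\<Sum>i<3. l i)" by (intro tendsto_sum 6)
    ultimately show ?case
      using T.lim[of s l] 6 LIMSEQ_unique[OF tendsto_const[of "0::complex"], of "\<Sum>i<3. l i"] by (auto simp: sum_zero3_def)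
  qed (use assms T.supp T.zero T.add T.scale in
    \<open>auto simp: sum_zero3_def fun_scale_def sum.distrib sum_distrib_left[symmetric]\<close>)
qed

text \<open>The p-th power is that of the squared modulus with exponent p / 2. Its base at t = 0 is
  a^2 > 0, where real powers are differentiable, and Im z enters only to second order in t.\<close>

lemma DERIV_cmod_powr:
  assumes "a \<noteq> 0"
  shows "((\<lambda>t. cmod (complex_of_real a + complex_of_real t * z) powr p)
     has_real_derivative p * \<bar>a\<bar> powr (p - 2) * a * Re z) (at 0)"
proof -
  have eq: "cmod (complex_of_real a + complex_of_real t * z) powr p
      = ((a + t * Re z)\<^sup>2 + (t * Im z)\<^sup>2) powr (p / 2)" for t
    by (simp add: cmod_def powr_half_sqrt[symmetric] powr_powr)
  have "(a\<^sup>2) powr (p / 2 - 1) = \<bar>a\<bar> powr (p - 2)"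
    using assms powr_powr[of "\<bar>a\<bar>" 2 "p / 2 - 1"] by (simp add: powr_numeral algebra_simps)
  then show ?thesis
    unfolding eq using assms
    by (auto intro!: derivative_eq_intros simp: zero_less_power2)
qed

lemma no_contractive_projection:
  fixes p :: real
  assumes p: "1 < p" "p \<noteq> 2"
    and P: "\<And>x. x \<in> coord3 \<Longrightarrow> P x \<in> sum_zero3"
    and P_add: "\<And>x y. x \<in> coord3 \<Longrightarrow> y \<in> coord3 \<Longrightarrow> P (x + y) = P x + P y"
    and P_scale: "\<And>c x. x \<in> coord3 \<Longrightarrow> P (fun_scale c x) = fun_scale c (P x)"
    and P_id: "\<And>x. x \<in> sum_zero3 \<Longrightarrow> P x = x"
    and P_le: "\<And>x. x \<in> coord3 \<Longrightarrow> lpn p {..<3} (P x) \<le> lpn p {..<3} x"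
  shows False
proof -
  interpret T: lp_subspace p 3 coord3 by (rule lp_subspace_T[OF p(1)])
  interpret S: lp_subspace p 3 sum_zero3 by (rule lp_subspace_S[OF p(1)])
  have ST: "sum_zero3 \<subseteq> coord3" by (auto simp: sum_zero3_def)
  define \<delta> :: "nat \<Rightarrow> complex" where "\<delta> i = (if i = 0 then 1 else 0)" for i
  \<comment> \<open>Subtracting its projection puts \<open>\<delta>\<close> into the kernel of
    \<open>P\<close> and leaves the coordinate sum 1 unchanged.\<close>
  define h where "h = \<delta> + fun_scale (-1) (P \<delta>)"
  have \<delta>: "\<delta> \<in> coord3" by (simp add: coord3_def \<delta>_def)
  have P\<delta>: "P \<delta> \<in> sum_zero3" "P \<delta> \<in> coord3" using P[OF \<delta>] ST by auto
  have h: "h \<in> coord3" unfolding h_def by (intro T.add T.scale \<delta> P\<delta>)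
  have "P h = P \<delta> + fun_scale (-1) (P (P \<delta>))"
    unfolding h_def by (simp add: P_add P_scale T.scale \<delta> P\<delta>)
  then have Ph: "P h = 0" by (simp add: P_id P\<delta> fun_scale_def fun_eq_iff)
  have "(\<Sum>i<3. h i) = (\<Sum>i<3. \<delta> i) - (\<Sum>i<3. P \<delta> i)"
    by (simp add: h_def fun_scale_def sum_subtractf)
  also have "\<dots> = 1" using P\<delta> by (simp add: sum_zero3_def \<delta>_def eval_nat_numeral)
  finally have sum_h: "(\<Sum>i<3. h i) = 1" .
  \<comment> \<open>The three permutations of (2, -1, -1): they lie in the hyperplane, and no entry
    is 0, so every term below is differentiable at t = 0.\<close>
  define y :: "nat \<Rightarrow> nat \<Rightarrow> real" where "y k i = (if i = k then 2 else - 1)" for k i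
  have min: "(\<Sum>i<3. cmod (complex_of_real (y k i)) powr p)
      \<le> (\<Sum>i<3. cmod (complex_of_real (y k i) + complex_of_real t * h i) powr p)" if "k < 3" for k t
  proof -
    define x :: "nat \<Rightarrow> complex" where "x i = (if i < 3 then complex_of_real (y k i) else 0)" for i
    have "k = 0 \<or> k = 1 \<or> k = 2" using that by linarith
    then have "x \<in> sum_zero3" by (auto simp: sum_zero3_def coord3_def x_def y_def eval_nat_numeral)
    then have x: "x \<in> sum_zero3" "x \<in> coord3" using ST by auto
    \<comment> \<open>\<open>P\<close> fixes \<open>x\<close> and annihilates \<open>h\<close>, so
      contractivity compares \<open>x\<close> with its perturbation.\<close>
    have "P (x + fun_scale t h) = x"
      using x h by (simp add: P_add P_scale T.scale P_id Ph) (simp add: fun_scale_def fun_eq_iff)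
    then have "lpn p {..<3} x \<le> lpn p {..<3} (x + fun_scale t h)"
      using P_le[of "x + fun_scale t h"] T.add[OF x(2) T.scale[OF h]] by simp
    then have "lpn p {..<3} x powr p \<le> lpn p {..<3} (x + fun_scale t h) powr p"
      using p by (intro powr_mono2) auto
    then show ?thesis by (simp add: lpn_powr[OF p(1)] x_def fun_scale_def)
  qed
  \<comment> \<open>Summing over the permutations makes the derivative symmetric in the coordinates
    of \<open>h\<close>, so that only their known sum enters.\<close>
  let ?G = "\<lambda>t. \<Sum>k<3. \<Sum>i<3. cmod (complex_of_real (y k i) + complex_of_real t * h i) powr p"
  let ?D = "\<Sum>k<3. \<Sum>i<3. p * \<bar>y k i\<bar> powr (p - 2) * y k i * Re (h i)"
  have "(?G has_real_derivative ?D) (at 0)"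
    by (intro DERIV_sum DERIV_cmod_powr) (simp add: y_def)
  moreover have "?G 0 \<le> ?G t" for t
    by (rule sum_mono) (use min in simp)
  ultimately have "?D = 0"
    using DERIV_local_min[of ?G ?D 0 1] by simp
  \<comment> \<open>Each coordinate of \<open>h\<close> meets the entry 2 once and the entry -1
    twice.\<close>
  moreover have "?D = p * (2 powr (p - 2) * 2 - 2) * Re (\<Sum>i<3. h i)"
    by (simp add: y_def eval_nat_numeral algebra_simps)
  ultimately have "2 powr (p - 2) = (2::real) powr 0"
    using p by (simp add: sum_h)
  then show False using p by (simp add: powr_eq_one_iff_gen)
qed

text \<open>The Hoelder bound for the functional (1, -1, 0), whose dual norm is 2^(1 - 1/p), the
  reciprocal of the factor here. It follows from convexity at the midpoint of the two moduli;
  omitting the third coordinate can only lower the norm.\<close>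

lemma two_coordinate_bound:
  fixes x :: "nat \<Rightarrow> complex"
  assumes "1 < p"
  shows "cmod ((x 0 - x 1) * complex_of_real (2 powr (1 / p) / 2)) \<le> lpn p {..<3} x"
proof -
  let ?a = "cmod (x 0)" and ?b = "cmod (x 1)"
  have "((1 - 1 / 2) * ?a + 1 / 2 * ?b) powr p \<le> (1 - 1 / 2) * ?a powr p + 1 / 2 * ?b powr p"
    by (rule powr_convex_combination) (use assms in auto)
  then have conv: "2 * ((?a + ?b) / 2) powr p \<le> ?a powr p + ?b powr p"
    by (simp add: field_simps)
  have "cmod ((x 0 - x 1) * complex_of_real (2 powr (1 / p) / 2)) = cmod (x 0 - x 1) * (2 powr (1 / p) / 2)"
    by (simp add: norm_mult norm_divide)
  also have "\<dots> \<le> (?a + ?b) * (2 powr (1 / p) / 2)"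
    by (intro mult_right_mono norm_triangle_ineq4) auto
  also have "\<dots> = (2 * ((?a + ?b) / 2) powr p) powr (1 / p)"
    using assms by (simp add: powr_mult powr_powr)
  also have "\<dots> \<le> (?a powr p + ?b powr p) powr (1 / p)"
    using conv assms by (intro powr_mono2) auto
  also have "\<dots> \<le> lpn p {..<3} x"
    unfolding lpn_def using assms by (intro powr_mono2) (auto simp: eval_nat_numeral lessThan_Suc)
  finally show ?thesis .
qed

theorem mainTheorem1:
  fixes p :: real
  assumes "1 < p" and "p \<noteq> 2"
  shows "\<exists>(V :: (nat \<Rightarrow> complex) pspace) (W :: (nat \<Rightarrow> complex) pspace)
           (E :: (nat \<Rightarrow> complex) cspace) (\<phi> :: (nat \<Rightarrow> complex) \<Rightarrow> (nat \<Rightarrow> complex) \<Rightarrow> nat \<Rightarrow> complex).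
           p_operator_space p V \<and> p_operator_space p W \<and> p_subspace V W \<and>
           SQ_p TYPE(real \<Rightarrow> real) p E \<and>
           p_completely_contractive V (op_space p E) \<phi> \<and>
           \<not> (\<exists>\<psi>. p_completely_contractive W (op_space p E) \<psi> \<and> (\<forall>x\<in>carr V. \<psi> x = \<phi> x))"
proof -
  interpret T: lp_subspace p 3 coord3 by (rule lp_subspace_T[OF assms(1)])
  interpret S: lp_subspace p 3 sum_zero3 by (rule lp_subspace_S[OF assms(1)])
  have ST: "sum_zero3 \<subseteq> coord3" by (auto simp: sum_zero3_def)
  \<comment> \<open>The scaling makes \<open>f\<close> contractive and \<open>e\<close> a unit
    vector with f e = 1, so that \<open>f\<close> attains its norm at \<open>e\<close>.\<close>
  define \<kappa> where "\<kappa> = complex_of_real (2 powr (1 / p) / 2)"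
  define f :: "(nat \<Rightarrow> complex) \<Rightarrow> complex" where
    "f x = (x 0 - x 1) * \<kappa>" for x
  define e :: "nat \<Rightarrow> complex" where
    "e i = (if i = 0 then 1 else if i = 1 then -1 else 0) * complex_of_real (1 / 2 powr (1 / p))" for i
  have "p_completely_contractive (col_space p 3 sum_zero3) (op_space p (lp_space p 3 sum_zero3)) (rank_one sum_zero3 f)"
  proof (rule S.rank_one_completely_contractive)
    show "cmod (f x) \<le> lpn p {..<3} x" for x
      unfolding f_def \<kappa>_def by (rule two_coordinate_bound[OF assms(1)])
  qed (simp_all add: f_def fun_scale_def algebra_simps)
  \<comment> \<open>The formula for the matrix norms does not mention the carrier, so the norms are
    inherited and closedness is what remains.\<close>
  moreover have "p_subspace (col_space p 3 sum_zero3) (col_space p 3 coord3)"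
    unfolding p_subspace_def using S.closed_in_lpn[OF ST] T.supp by simp
  moreover have "\<not> (\<exists>\<psi>. p_completely_contractive (col_space p 3 coord3) (op_space p (lp_space p 3 sum_zero3)) \<psi>
      \<and> (\<forall>x\<in>sum_zero3. \<psi> x = rank_one sum_zero3 f x))"
  proof
    assume "\<exists>\<psi>. p_completely_contractive (col_space p 3 coord3) (op_space p (lp_space p 3 sum_zero3)) \<psi>
      \<and> (\<forall>x\<in>sum_zero3. \<psi> x = rank_one sum_zero3 f x)"
    then obtain \<psi> where \<psi>: "p_completely_contractive (col_space p 3 coord3) (op_space p (lp_space p 3 sum_zero3)) \<psi>"
      and ext: "\<And>x. x \<in> sum_zero3 \<Longrightarrow> \<psi> x = rank_one sum_zero3 f x" by blast
    have e: "e \<in> sum_zero3" by (simp add: sum_zero3_def coord3_def e_def eval_nat_numeral)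
    have "(\<Sum>i<3. cmod (e i) powr p) = 1"
      using assms(1) by (simp add: e_def eval_nat_numeral norm_divide powr_divide powr_powr)
    then have e1: "lpn p {..<3} e \<le> 1" by (simp add: lpn_def)
    have fe: "f e = 1"
      by (simp add: f_def \<kappa>_def e_def)
    have lin: "\<psi> x \<in> bounded_ops (lp_space p 3 sum_zero3)" "\<psi> (x + y) = \<psi> x + \<psi> y"
      "\<psi> (fun_scale c x) = (\<lambda>z. fun_scale c (\<psi> x z))" if "x \<in> coord3" "y \<in> coord3" for x y c
      using \<psi> that unfolding p_completely_contractive_def linear_map_def by (simp_all add: op_space_def)
    show False
    proof (rule no_contractive_projection[OF assms, of "\<lambda>x. \<psi> x e"])
      show "\<psi> x e \<in> sum_zero3" if "x \<in> coord3" for x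
        using lin(1)[OF that that] e by (simp add: bounded_ops_def linear_map_def)
      \<comment> \<open>On the hyperplane, \<open>\<psi> x\<close> sends \<open>e\<close> to f(e) x,
        and f e = 1.\<close>
      show "\<psi> x e = x" if "x \<in> sum_zero3" for x
        using e fe by (simp add: ext[OF that] rank_one_def fun_scale_def)
      show "lpn p {..<3} (\<psi> x e) \<le> lpn p {..<3} x" if "x \<in> coord3" for x
        using S.evaluation_contractive[OF \<psi> T.lp_subspace_axioms e e1 that] .
    qed (use lin in simp_all)
  qed
  ultimately show ?thesis
    using S.p_operator_space_col T.p_operator_space_col S.SQ_p_lp_space
    by (intro exI[of _ "col_space p 3 sum_zero3"] exI[of _ "col_space p 3 coord3"] exI[of _ "lp_space p 3 sum_zero3"]
          exI[of _ "rank_one sum_zero3 f"]) simp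
qed

end
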